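(* Let $n\ge 1$ and let $C$ be a $3\times 2n$ pairing matrix that defines an invertible pairing. Assume that the generators $a_1,a_2,a_3$ are pairwise distinct in the group $\Gamma_C$ and that the generators $b_1,\ldots,b_{2n}$ are pairwise distinct in $\Gamma_C$. Then $\Gamma_C$ contains a nontrivial element of finite order.
   Context: A pairing matrix is an $n\times m$ matrix $C=(c_{ij})$ with $nm$ even and entries $c_{ij}\in\{1,2,\ldots,nm/2\}$ such that no row or column contains a repeated value, and for every pair of indices $(i,j)$ there exists exactly one pair $(i',j')\neq(i,j)$ with $c_{ij}=c_{i'j'}$. To an $n\times m$ pairing matrix $C$ one associates the finitely presented group $$\Gamma_C=\langle a_1,\ldots,a_n,b_1,\ldots,b_m \mid a_ib_j=a_{i'}b_{j'} \text{ whenever } c_{ij}=c_{i'j'}\rangle.$$ A pairing matrix $C$ defines an invertible pairing if every row and every column of $C$ have exactly one equal coefficient besides the common coefficient in their intersection; that is, for every row index $i$ and every column index $l$ there is exactly one pair $(j,i')$ with $j\neq l$, $i'\neq i$ and $c_{ij}=c_{i'l}$. (Equivalently, for every row $i$, the map $j\mapsto j'$ on $\{1,\ldots,m\}$, where $(i',j')\ne(i,j)$ is the unique other position with $c_{ij}=c_{i'j'}$, is a permutation.) *)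

theory Defs
  imports "HOL-Algebra.Group"
begin

text \<open>
  A letter \<open>(True, x)\<close> stands for the generator \<open>x\<close>, and \<open>(False, x)\<close> for its formal inverse.
  A pair \<open>(u, v)\<close> in \<open>R\<close> stands for the defining relation \<open>u = v\<close>.
\<close>

definition words :: "'g set \<Rightarrow> (bool \<times> 'g) list set" where
  "words X = lists (UNIV \<times> X)"

inductive word_eq ::
    "'g set \<Rightarrow> ((bool \<times> 'g) list \<times> (bool \<times> 'g) list) set \<Rightarrow>
     (bool \<times> 'g) list \<Rightarrow> (bool \<times> 'g) list \<Rightarrow> bool"
  for X R where
  refl: "w \<in> words X \<Longrightarrow> word_eq X R w w"
| sym: "word_eq X R u v \<Longrightarrow> word_eq X R v u"
| trans: "word_eq X R u v \<Longrightarrow> word_eq X R v w \<Longrightarrow> word_eq X R u w"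
| cong: "word_eq X R u v \<Longrightarrow> s \<in> words X \<Longrightarrow> t \<in> words X \<Longrightarrow>
    word_eq X R (s @ u @ t) (s @ v @ t)"
| cancel: "x \<in> X \<Longrightarrow> word_eq X R [(e, x), (\<not> e, x)] []"
| relation: "(u, v) \<in> R \<Longrightarrow> u \<in> words X \<Longrightarrow> v \<in> words X \<Longrightarrow> word_eq X R u v"

definition word_class ::
    "'g set \<Rightarrow> ((bool \<times> 'g) list \<times> (bool \<times> 'g) list) set \<Rightarrow>
     (bool \<times> 'g) list \<Rightarrow> (bool \<times> 'g) list set" where
  "word_class X R w = {v. word_eq X R w v}"

definition presented_group ::
    "'g set \<Rightarrow> ((bool \<times> 'g) list \<times> (bool \<times> 'g) list) set \<Rightarrow> (bool \<times> 'g) list set monoid" where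
  "presented_group X R =
    \<lparr>carrier = word_class X R ` words X,
     mult = (\<lambda>U V. \<Union>u\<in>U. \<Union>v\<in>V. word_class X R (u @ v)),
     one = word_class X R []\<rparr>"

lemma word_eq_words:
  assumes "word_eq X R u v"
  shows "u \<in> words X \<and> v \<in> words X"
  using assms by induction (auto simp: words_def)

lemma word_class_eq_iff:
  assumes "u \<in> words X"
  shows "word_class X R u = word_class X R v \<longleftrightarrow> word_eq X R u v"
proof
  assume "word_class X R u = word_class X R v"
  moreover have "u \<in> word_class X R u"
    using assms by (simp add: word_class_def word_eq.refl)
  ultimately have "u \<in> word_class X R v" by simp
  then show "word_eq X R u v" by (simp add: word_class_def word_eq.sym)
next
  assume "word_eq X R u v"
  then show "word_class X R u = word_class X R v"
    unfolding word_class_def using word_eq.sym word_eq.trans by blast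
qed

lemma word_eq_append:
  assumes "word_eq X R u u'" "word_eq X R v v'"
  shows "word_eq X R (u @ v) (u' @ v')"
proof -
  have nil: "[] \<in> words X" by (simp add: words_def)
  have "word_eq X R ([] @ u @ v) ([] @ u' @ v)"
    using word_eq_words[OF assms(2)] nil by (intro word_eq.cong assms(1)) auto
  moreover have "word_eq X R (u' @ v @ []) (u' @ v' @ [])"
    using word_eq_words[OF assms(1)] nil by (intro word_eq.cong assms(2)) auto
  ultimately show ?thesis using word_eq.trans[of X R "u @ v" "u' @ v" "u' @ v'"] by simp
qed

lemma presented_group_mult:
  assumes "u \<in> words X" "v \<in> words X"
  shows "word_class X R u \<otimes>\<^bsub>presented_group X R\<^esub> word_class X R v = word_class X R (u @ v)"
proof -
  have uv: "u @ v \<in> words X" using assms by (simp add: words_def)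
  have eq: "word_class X R (u' @ v') = word_class X R (u @ v)"
    if "u' \<in> word_class X R u" "v' \<in> word_class X R v" for u' v'
  proof -
    have "word_eq X R (u @ v) (u' @ v')"
      using that by (intro word_eq_append) (simp_all add: word_class_def)
    then show ?thesis using word_class_eq_iff[OF uv] by blast
  qed
  have "u \<in> word_class X R u" "v \<in> word_class X R v"
    using assms by (simp_all add: word_class_def word_eq.refl)
  then have "(\<Union>u'\<in>word_class X R u. \<Union>v'\<in>word_class X R v. word_class X R (u' @ v')) =
      word_class X R (u @ v)"
    using eq by blast
  then show ?thesis by (simp add: presented_group_def)
qed

lemma word_inverse:
  assumes "w \<in> words X"
  shows "\<exists>w'\<in>words X. word_eq X R (w' @ w) []"
  using assms
proof (induction w)
  case Nil
  then show ?case by (intro bexI[of _ "[]"]) (simp_all add: word_eq.refl)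
next
  case (Cons a w)
  obtain e x where a: "a = (e, x)" by (cases a)
  have x: "x \<in> X" and w: "w \<in> words X" using Cons.prems a by (auto simp: words_def)
  obtain w' where w': "w' \<in> words X" "word_eq X R (w' @ w) []" using Cons.IH w by blast
  have "word_eq X R (w' @ [(\<not> e, x), (\<not> \<not> e, x)] @ w) (w' @ [] @ w)"
    by (rule word_eq.cong[OF word_eq.cancel[OF x] w'(1) w])
  then have "word_eq X R ((w' @ [(\<not> e, x)]) @ (a # w)) []"
    using word_eq.trans[OF _ w'(2)] a by simp
  moreover have "w' @ [(\<not> e, x)] \<in> words X" using w' x by (auto simp: words_def)
  ultimately show ?case by blast
qed

lemma group_presented_group: "group (presented_group X R)"
proof (rule groupI)
  let ?G = "presented_group X R"
  have carr: "carrier ?G = word_class X R ` words X" and one: "\<one>\<^bsub>?G\<^esub> = word_class X R []"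
    by (simp_all add: presented_group_def)
  have nil: "[] \<in> words X" by (simp add: words_def)
  have app: "u @ v \<in> words X" if "u \<in> words X" "v \<in> words X" for u v
    using that by (simp add: words_def)
  show "\<one>\<^bsub>?G\<^esub> \<in> carrier ?G" using nil carr one by simp
  show "x \<otimes>\<^bsub>?G\<^esub> y \<in> carrier ?G" if "x \<in> carrier ?G" "y \<in> carrier ?G" for x y
    using that app by (auto simp: carr presented_group_mult)
  show "x \<otimes>\<^bsub>?G\<^esub> y \<otimes>\<^bsub>?G\<^esub> z = x \<otimes>\<^bsub>?G\<^esub> (y \<otimes>\<^bsub>?G\<^esub> z)"
    if "x \<in> carrier ?G" "y \<in> carrier ?G" "z \<in> carrier ?G" for x y z
    using that app by (auto simp: carr presented_group_mult)
  show "\<one>\<^bsub>?G\<^esub> \<otimes>\<^bsub>?G\<^esub> x = x" if "x \<in> carrier ?G" for x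
    using that nil by (auto simp: carr one presented_group_mult)
  show "\<exists>y\<in>carrier ?G. y \<otimes>\<^bsub>?G\<^esub> x = \<one>\<^bsub>?G\<^esub>" if x: "x \<in> carrier ?G" for x
  proof -
    obtain w where w: "w \<in> words X" "x = word_class X R w" using x carr by auto
    obtain w' where w': "w' \<in> words X" "word_eq X R (w' @ w) []" using word_inverse w by blast
    have "word_class X R w' \<otimes>\<^bsub>?G\<^esub> x = \<one>\<^bsub>?G\<^esub>"
      using w w' app by (simp add: one presented_group_mult word_class_eq_iff)
    then show ?thesis using w' carr by auto
  qed
qed

text \<open>
  An \<open>n \<times> m\<close> matrix is a function \<open>C\<close> of which only the values \<open>C i j\<close> with
  \<open>1 \<le> i \<le> n\<close> and \<open>1 \<le> j \<le> m\<close> are relevant.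
\<close>

definition pairing_matrix :: "nat \<Rightarrow> nat \<Rightarrow> (nat \<Rightarrow> nat \<Rightarrow> nat) \<Rightarrow> bool" where
  "pairing_matrix n m C \<longleftrightarrow>
    even (n * m) \<and>
    (\<forall>i\<in>{1..n}. \<forall>j\<in>{1..m}. C i j \<in> {1..n * m div 2}) \<and>
    (\<forall>i\<in>{1..n}. inj_on (\<lambda>j. C i j) {1..m}) \<and>
    (\<forall>j\<in>{1..m}. inj_on (\<lambda>i. C i j) {1..n}) \<and>
    (\<forall>i\<in>{1..n}. \<forall>j\<in>{1..m}.
      \<exists>!(i', j'). i' \<in> {1..n} \<and> j' \<in> {1..m} \<and> (i', j') \<noteq> (i, j) \<and> C i j = C i' j')"

definition invertible_pairing :: "nat \<Rightarrow> nat \<Rightarrow> (nat \<Rightarrow> nat \<Rightarrow> nat) \<Rightarrow> bool" where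
  "invertible_pairing n m C \<longleftrightarrow>
    (\<forall>i\<in>{1..n}. \<forall>l\<in>{1..m}.
      \<exists>!(j, i'). j \<in> {1..m} \<and> i' \<in> {1..n} \<and> j \<noteq> l \<and> i' \<noteq> i \<and> C i j = C i' l)"

datatype generator = A nat | B nat

definition pairing_gens :: "nat \<Rightarrow> nat \<Rightarrow> generator set" where
  "pairing_gens n m = A ` {1..n} \<union> B ` {1..m}"

definition pairing_rels ::
    "nat \<Rightarrow> nat \<Rightarrow> (nat \<Rightarrow> nat \<Rightarrow> nat) \<Rightarrow>
     ((bool \<times> generator) list \<times> (bool \<times> generator) list) set" where
  "pairing_rels n m C =
    {([(True, A i), (True, B j)], [(True, A i'), (True, B j')]) | i j i' j'.
      i \<in> {1..n} \<and> j \<in> {1..m} \<and> i' \<in> {1..n} \<and> j' \<in> {1..m} \<and> C i j = C i' j'}"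

definition pairing_group ::
    "nat \<Rightarrow> nat \<Rightarrow> (nat \<Rightarrow> nat \<Rightarrow> nat) \<Rightarrow> (bool \<times> generator) list set monoid" where
  "pairing_group n m C = presented_group (pairing_gens n m) (pairing_rels n m C)"

definition gen_a :: "nat \<Rightarrow> nat \<Rightarrow> (nat \<Rightarrow> nat \<Rightarrow> nat) \<Rightarrow> nat \<Rightarrow> (bool \<times> generator) list set" where
  "gen_a n m C i = word_class (pairing_gens n m) (pairing_rels n m C) [(True, A i)]"

definition gen_b :: "nat \<Rightarrow> nat \<Rightarrow> (nat \<Rightarrow> nat \<Rightarrow> nat) \<Rightarrow> nat \<Rightarrow> (bool \<times> generator) list set" where
  "gen_b n m C j = word_class (pairing_gens n m) (pairing_rels n m C) [(True, B j)]"

end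

theory Submission
  imports Defs
begin

text \<open>
  View the columns as vertices of a cubic graph, joining \<open>l\<close> and \<open>j\<close> when \<open>c\<^sub>i\<^sub>l = c\<^sub>i\<^sub>'\<^sub>j\<close>.
  Invertibility makes \<open>i \<mapsto> i'\<close> a derangement of the three rows for every fixed column \<open>l\<close>, so a
  3-cycle in one of the two possible directions, and edges join columns of opposite directions.
  Hence each \<open>x\<^sub>i = a\<^sub>i\<^sub>+\<^sub>1\<inverse> a\<^sub>i\<close> (indices mod 3) maps the set \<open>S\<close> of the \<open>b\<^sub>l\<close> of one direction
  bijectively onto the set \<open>T\<close> of those of the other, and \<open>x\<^sub>i\<inverse> x\<^sub>k\<close> stabilises the finite set \<open>S\<close>
  under left multiplication, so it has finite order. If all of these are trivial,
  then \<open>x\<^sub>1 = x\<^sub>2 = x\<^sub>3\<close> and \<open>x\<^sub>1\<^sup>3 = x\<^sub>3 x\<^sub>2 x\<^sub>1 = 1\<close>, while \<open>x\<^sub>1 \<noteq> 1\<close> because \<open>a\<^sub>1 \<noteq> a\<^sub>2\<close>.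
\<close>

section \<open>Torsion criteria in an abstract group\<close>

lemma (in group) finite_order_if_stabilises_finite:
  assumes g: "g \<in> carrier G" and S: "finite S" "S \<noteq> {}" "S \<subseteq> carrier G"
    and stab: "\<And>s. s \<in> S \<Longrightarrow> g \<otimes> s \<in> S"
  shows "\<exists>k::nat. k > 0 \<and> g [^] k = \<one>"
proof -
  obtain s where s: "s \<in> S" "s \<in> carrier G" using S by blast
  have pow: "g [^] k \<otimes> s \<in> S" for k :: nat
  proof (induction k)
    case (Suc k)
    have "g [^] Suc k \<otimes> s = g \<otimes> (g [^] k \<otimes> s)"
      using g s by (subst nat_pow_Suc2) (simp_all add: m_assoc)
    then show ?case using stab Suc by simp
  qed (use s in simp)
  \<comment> \<open>Pigeonhole: the orbit of \<open>s\<close> stays in the finite set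
    \<open>S\<close>, so two different powers of \<open>g\<close> agree on \<open>s\<close>;
    cancelling \<open>s\<close> makes them equal.\<close>
  have "\<not> inj (\<lambda>k::nat. g [^] k \<otimes> s)"
    using pow S(1) by (metis (no_types, lifting) finite_imageD finite_subset image_subsetI infinite_UNIV_nat)
  then obtain i j :: nat where "i \<noteq> j" "g [^] i \<otimes> s = g [^] j \<otimes> s"
    by (auto simp: inj_def)
  then obtain i j :: nat where ij: "i < j" "g [^] i \<otimes> s = g [^] j \<otimes> s"
    by (metis linorder_neq_iff)
  then have "g [^] i = g [^] j" using g s by simp
  moreover have "g [^] i \<otimes> g [^] (j - i) = g [^] j"
    using nat_pow_mult[OF g, of i "j - i"] ij by simp
  ultimately have "g [^] i \<otimes> g [^] (j - i) = g [^] i \<otimes> \<one>"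
    using g by simp
  then have "g [^] (j - i) = \<one>" using g by simp
  then show ?thesis using ij by (intro exI[of _ "j - i"]) simp
qed

text \<open>\<open>y\<close> carries \<open>S\<close> into \<open>T\<close> and \<open>inv x\<close>
  carries \<open>T\<close> back into \<open>S\<close>, so the witness
  \<open>inv x \<otimes> y\<close> stabilises \<open>S\<close>.\<close>

lemma (in group) torsion_if_translates_agree:
  assumes X: "X \<subseteq> carrier G" and S: "finite S" "S \<noteq> {}" "S \<subseteq> carrier G"
    and ST: "\<And>x s. x \<in> X \<Longrightarrow> s \<in> S \<Longrightarrow> x \<otimes> s \<in> T"
    and TS: "\<And>x t. x \<in> X \<Longrightarrow> t \<in> T \<Longrightarrow> inv x \<otimes> t \<in> S"
    and xy: "x \<in> X" "y \<in> X" "x \<noteq> y"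
  shows "\<exists>g\<in>carrier G. g \<noteq> \<one> \<and> (\<exists>k::nat. k > 0 \<and> g [^] k = \<one>)"
proof (intro bexI conjI)
  have c: "x \<in> carrier G" "y \<in> carrier G" using X xy by auto
  show "inv x \<otimes> y \<in> carrier G" using c by simp
  show "inv x \<otimes> y \<noteq> \<one>"
    using c xy(3) by (metis inv_equality inv_inv inv_closed)
  show "\<exists>k::nat. k > 0 \<and> (inv x \<otimes> y) [^] k = \<one>"
  proof (rule finite_order_if_stabilises_finite[OF _ S])
    show "inv x \<otimes> y \<otimes> s \<in> S" if "s \<in> S" for s
      using TS[OF xy(1) ST[OF xy(2) that]] S(3) that c by (auto simp: m_assoc subset_iff)
  qed (use c in simp)
qed

lemma (in group) torsion_if_three_differences_agree:
  assumes a: "a1 \<in> carrier G" "a2 \<in> carrier G" "a3 \<in> carrier G" "a1 \<noteq> a2"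
    and S: "finite S" "S \<noteq> {}" "S \<subseteq> carrier G"
    and ST: "\<And>x s. x \<in> {inv a2 \<otimes> a1, inv a3 \<otimes> a2, inv a1 \<otimes> a3} \<Longrightarrow> s \<in> S \<Longrightarrow> x \<otimes> s \<in> T"
    and TS: "\<And>x t. x \<in> {inv a2 \<otimes> a1, inv a3 \<otimes> a2, inv a1 \<otimes> a3} \<Longrightarrow> t \<in> T \<Longrightarrow> inv x \<otimes> t \<in> S"
  shows "\<exists>g\<in>carrier G. g \<noteq> \<one> \<and> (\<exists>k::nat. k > 0 \<and> g [^] k = \<one>)"
proof (cases "inv a2 \<otimes> a1 = inv a3 \<otimes> a2 \<and> inv a2 \<otimes> a1 = inv a1 \<otimes> a3")
  case True
  define x where "x = inv a2 \<otimes> a1"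
  have cancel: "u \<otimes> (inv u \<otimes> v) = v" if "u \<in> carrier G" "v \<in> carrier G" for u v
    using that by (simp add: m_assoc[symmetric])
  have x: "x \<in> carrier G" "a1 = a2 \<otimes> x" "a2 = a3 \<otimes> x" "a3 = a1 \<otimes> x"
    using a True cancel[of a2 a1] cancel[of a3 a2] cancel[of a1 a3] unfolding x_def by auto
  \<comment> \<open>Once around the cycle of rows:
    \<open>a1 = a2 x = a3 x x = a1 x x x\<close>.\<close>
  have "a1 \<otimes> (x \<otimes> x \<otimes> x) = a1 \<otimes> \<one>"
    using x a by (metis m_assoc m_closed r_one)
  then have "x [^] (3::nat) = \<one>"
    using x(1) a by (simp add: numeral_3_eq_3)
  moreover have "x \<noteq> \<one>" using x(2) a(2,4) r_one by metis
  ultimately show ?thesis using x(1) by (intro bexI[of _ x] conjI exI[of _ 3]) auto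
next
  case False
  have "{inv a2 \<otimes> a1, inv a3 \<otimes> a2, inv a1 \<otimes> a3} \<subseteq> carrier G" using a by simp
  from torsion_if_translates_agree[OF this S ST TS] False show ?thesis by blast
qed

section \<open>Directions of the columns of a pairing matrix\<close>

lemma ex1_pairD:
  assumes "\<exists>!(x, y). P x y"
  shows "\<exists>x y. P x y" and "P x y \<Longrightarrow> P x' y' \<Longrightarrow> x = x' \<and> y = y'"
  using assms by auto

text \<open>An arrow from row \<open>i\<close> to row \<open>i'\<close> at column \<open>l\<close>.
  For \<open>i = i'\<close> the choice \<open>j = l\<close> makes it trivial, so the uniqueness
  lemmas ask for \<open>i' \<noteq> i\<close>.\<close>

definition meets :: "nat \<Rightarrow> (nat \<Rightarrow> nat \<Rightarrow> nat) \<Rightarrow> nat \<Rightarrow> nat \<Rightarrow> nat \<Rightarrow> bool" where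
  "meets m C i i' l \<longleftrightarrow> (\<exists>j\<in>{1..m}. C i l = C i' j)"

text \<open>The partner of the cell \<open>(i, l)\<close> lies outside row \<open>i\<close>, since
  rows have no repeated value.\<close>

lemma meets_unique_target:
  assumes "pairing_matrix n m C" "i \<in> {1..n}" "l \<in> {1..m}"
  shows "\<exists>!i'. i' \<in> {1..n} \<and> i' \<noteq> i \<and> meets m C i i' l"
proof -
  have ex: "\<exists>!(i', j'). i' \<in> {1..n} \<and> j' \<in> {1..m} \<and> (i', j') \<noteq> (i, l) \<and> C i l = C i' j'"
    using assms(1) unfolding pairing_matrix_def 
    by (elim conjE) (rule bspec[OF bspec[OF _ assms(2)] assms(3)])
  have inj: "inj_on (C i) {1..m}"
    using assms(1,2) unfolding pairing_matrix_def by simp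
  obtain i' j' where p: "i' \<in> {1..n}" "j' \<in> {1..m}" "(i', j') \<noteq> (i, l)" "C i l = C i' j'"
    using ex1_pairD(1)[OF ex] by blast
  have "i' \<noteq> i" using p inj_onD[OF inj _ assms(3) p(2)] by metis
  then have "i' \<in> {1..n} \<and> i' \<noteq> i \<and> meets m C i i' l" using p unfolding meets_def by blast
  then show ?thesis
  proof (rule ex1I)
    fix k assume k: "k \<in> {1..n} \<and> k \<noteq> i \<and> meets m C i k l"
    then obtain j where "j \<in> {1..m}" "C i l = C k j" by (auto simp: meets_def)
    then show "k = i'" using k ex1_pairD(2)[OF ex, of k j i' j'] p by blast
  qed
qed

text \<open>This is invertibility for row \<open>i\<close> and column \<open>l\<close>; its
  condition \<open>j \<noteq> l\<close> comes for free because columns have no repeated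
  value.\<close>

lemma meets_unique_source:
  assumes "pairing_matrix n m C" "invertible_pairing n m C" "i \<in> {1..n}" "l \<in> {1..m}"
  shows "\<exists>!i'. i' \<in> {1..n} \<and> i' \<noteq> i \<and> meets m C i' i l"
proof -
  have ex: "\<exists>!(j, i'). j \<in> {1..m} \<and> i' \<in> {1..n} \<and> j \<noteq> l \<and> i' \<noteq> i \<and> C i j = C i' l"
    using assms unfolding invertible_pairing_def by blast
  have inj: "inj_on (\<lambda>i. C i l) {1..n}"
    using assms unfolding pairing_matrix_def by blast
  obtain j' i' where p: "j' \<in> {1..m}" "i' \<in> {1..n}" "j' \<noteq> l" "i' \<noteq> i" "C i j' = C i' l"
    using ex1_pairD(1)[OF ex] by blast
  then have "i' \<in> {1..n} \<and> i' \<noteq> i \<and> meets m C i' i l" unfolding meets_def by metis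
  then show ?thesis
  proof (rule ex1I)
    fix k assume k: "k \<in> {1..n} \<and> k \<noteq> i \<and> meets m C k i l"
    then obtain j where j: "j \<in> {1..m}" "C k l = C i j" by (auto simp: meets_def)
    then have "j \<noteq> l" using k inj_onD[OF inj, of k i] assms(3) by blast
    then show "k = i'" using j k ex1_pairD(2)[OF ex, of j k j' i'] p by simp
  qed
qed

text \<open>With unique targets and sources, the arrows at \<open>l\<close> form a derangement of
  three rows, hence a 3-cycle, and \<open>meets m C 1 2 l\<close> decides which one.\<close>

lemma meets_direction:
  assumes "pairing_matrix 3 m C" "invertible_pairing 3 m C" "l \<in> {1..m}"
  shows "meets m C 2 3 l \<longleftrightarrow> meets m C 1 2 l" "meets m C 3 1 l \<longleftrightarrow> meets m C 1 2 l"
    "meets m C 2 1 l \<longleftrightarrow> \<not> meets m C 1 2 l" "meets m C 3 2 l \<longleftrightarrow> \<not> meets m C 1 2 l"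
    "meets m C 1 3 l \<longleftrightarrow> \<not> meets m C 1 2 l"
proof -
  have r: "i \<in> {1..3} \<longleftrightarrow> i = 1 \<or> i = 2 \<or> i = 3" for i :: nat by auto
  have t: "\<exists>!i'. (i' = 1 \<or> i' = 2 \<or> i' = 3) \<and> i' \<noteq> i \<and> meets m C i i' l"
    if "i = 1 \<or> i = 2 \<or> i = 3" for i
    using meets_unique_target[OF assms(1) _ assms(3), of i] that unfolding r .
  have s: "\<exists>!i'. (i' = 1 \<or> i' = 2 \<or> i' = 3) \<and> i' \<noteq> i \<and> meets m C i' i l"
    if "i = 1 \<or> i = 2 \<or> i = 3" for i
    using meets_unique_source[OF assms(1,2) _ assms(3), of i] that unfolding r .
  have d: "(1::nat) \<noteq> 2" "(1::nat) \<noteq> 3" "(2::nat) \<noteq> 3" by auto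
  \<comment> \<open>Each row has exactly one of the other two as target (\<open>t'\<close>) and
    exactly one as source (\<open>s'\<close>); chaining these exclusive alternatives fixes all six
    arrows.\<close>
  have t': "meets m C 1 2 l \<noteq> meets m C 1 3 l" "meets m C 2 1 l \<noteq> meets m C 2 3 l"
    "meets m C 3 1 l \<noteq> meets m C 3 2 l"
    using t[of 1] t[of 2] t[of 3] d by metis+
  have s': "meets m C 2 1 l \<noteq> meets m C 3 1 l" "meets m C 1 2 l \<noteq> meets m C 3 2 l"
    "meets m C 1 3 l \<noteq> meets m C 2 3 l"
    using s[of 1] s[of 2] s[of 3] d by metis+
  show "meets m C 2 3 l \<longleftrightarrow> meets m C 1 2 l" "meets m C 3 1 l \<longleftrightarrow> meets m C 1 2 l"
    "meets m C 2 1 l \<longleftrightarrow> \<not> meets m C 1 2 l" "meets m C 3 2 l \<longleftrightarrow> \<not> meets m C 1 2 l"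
    "meets m C 1 3 l \<longleftrightarrow> \<not> meets m C 1 2 l"
    using t' s' by blast+
qed

section \<open>Generators and relations of the pairing group, and the conclusion\<close>

lemma gen_carrier:
  "i \<in> {1..n} \<Longrightarrow> gen_a n m C i \<in> carrier (pairing_group n m C)"
  "j \<in> {1..m} \<Longrightarrow> gen_b n m C j \<in> carrier (pairing_group n m C)"
  by (auto simp: gen_a_def gen_b_def pairing_group_def presented_group_def words_def
      pairing_gens_def intro!: imageI)

lemma pairing_group_relation:
  assumes "i \<in> {1..n}" "j \<in> {1..m}" "i' \<in> {1..n}" "j' \<in> {1..m}" "C i j = C i' j'"
  shows "gen_a n m C i \<otimes>\<^bsub>pairing_group n m C\<^esub> gen_b n m C j =
    gen_a n m C i' \<otimes>\<^bsub>pairing_group n m C\<^esub> gen_b n m C j'"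
proof -
  let ?X = "pairing_gens n m" and ?R = "pairing_rels n m C"
  have w: "[(True, A k)] \<in> words ?X" if "k \<in> {1..n}" for k
    using that by (auto simp: words_def pairing_gens_def)
  have w': "[(True, B k)] \<in> words ?X" if "k \<in> {1..m}" for k
    using that by (auto simp: words_def pairing_gens_def)
  have ww: "[(True, A k), (True, B k')] \<in> words ?X" if "k \<in> {1..n}" "k' \<in> {1..m}" for k k'
    using that by (auto simp: words_def pairing_gens_def)
  have "([(True, A i), (True, B j)], [(True, A i'), (True, B j')]) \<in> ?R"
    using assms unfolding pairing_rels_def by blast
  then have "word_eq ?X ?R [(True, A i), (True, B j)] [(True, A i'), (True, B j')]"
    using assms by (intro word_eq.relation ww)
  then have "word_class ?X ?R [(True, A i), (True, B j)] =
      word_class ?X ?R [(True, A i'), (True, B j')]"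
    using assms by (subst word_class_eq_iff) (auto intro: ww)
  then show ?thesis
    using assms by (simp add: pairing_group_def gen_a_def gen_b_def presented_group_mult w w')
qed

theorem theorem4:
  fixes n :: nat and C :: "nat \<Rightarrow> nat \<Rightarrow> nat"
  assumes "n \<ge> 1"
    and "pairing_matrix 3 (2 * n) C"
    and "invertible_pairing 3 (2 * n) C"
    and "inj_on (gen_a 3 (2 * n) C) {1..3}"
    and "inj_on (gen_b 3 (2 * n) C) {1..2 * n}"
  shows "\<exists>x\<in>carrier (pairing_group 3 (2 * n) C).
    x \<noteq> \<one>\<^bsub>pairing_group 3 (2 * n) C\<^esub> \<and>
    (\<exists>k::nat. k > 0 \<and> x [^]\<^bsub>pairing_group 3 (2 * n) C\<^esub> k = \<one>\<^bsub>pairing_group 3 (2 * n) C\<^esub>)"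
proof -
  define m where "m = 2 * n"
  define G where "G = pairing_group 3 m C"
  define a where "a = gen_a 3 m C"
  define b where "b = gen_b 3 m C"
  interpret group G unfolding G_def pairing_group_def by (rule group_presented_group)
  note dir = meets_direction[OF assms(2,3), folded m_def]
  have a: "a i \<in> carrier G" if "i \<in> {1..3}" for i
    using that unfolding a_def G_def by (rule gen_carrier)
  have b: "b j \<in> carrier G" if "j \<in> {1..m}" for j
    using that unfolding b_def G_def by (rule gen_carrier)
  \<comment> \<open>\<open>S\<close> belongs to the columns with cycle 1, 2, 3, 1 and
    \<open>T\<close> to those with the reverse cycle.\<close>
  define S where "S = b ` {l \<in> {1..m}. meets m C 1 2 l}"
  define T where "T = b ` {l \<in> {1..m}. \<not> meets m C 1 2 l}"
  have step: "inv\<^bsub>G\<^esub> a i' \<otimes>\<^bsub>G\<^esub> a i \<otimes>\<^bsub>G\<^esub> b l = b j"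
    if "i \<in> {1..3}" "i' \<in> {1..3}" "l \<in> {1..m}" "j \<in> {1..m}" "C i l = C i' j" for i i' l j
  proof -
    have "a i \<otimes>\<^bsub>G\<^esub> b l = a i' \<otimes>\<^bsub>G\<^esub> b j"
      using that unfolding a_def b_def G_def by (intro pairing_group_relation)
    then show ?thesis using that a b by (simp add: m_assoc inv_solve_left')
  qed
  have cases: "\<exists>i i'. (i, i') \<in> {(1, 2), (2, 3), (3, 1)} \<and> x = inv\<^bsub>G\<^esub> a i' \<otimes>\<^bsub>G\<^esub> a i"
    if "x \<in> {inv\<^bsub>G\<^esub> a 2 \<otimes>\<^bsub>G\<^esub> a 1, inv\<^bsub>G\<^esub> a 3 \<otimes>\<^bsub>G\<^esub> a 2, inv\<^bsub>G\<^esub> a 1 \<otimes>\<^bsub>G\<^esub> a 3}" for x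
    using that by blast
  show ?thesis
    unfolding m_def[symmetric] G_def[symmetric]
  proof (rule torsion_if_three_differences_agree[of "a 1" "a 2" "a 3" S T])
    show "a 1 \<in> carrier G" "a 2 \<in> carrier G" "a 3 \<in> carrier G" using a by auto
    show "a 1 \<noteq> a 2" using assms(4) unfolding a_def m_def by (auto dest: inj_onD)
    show "finite S" "S \<subseteq> carrier G" using b by (auto simp: S_def)
    show "S \<noteq> {}"
    proof -
      have l: "1 \<in> {1..m}" using assms(1) by (simp add: m_def)
      show ?thesis
      proof (cases "meets m C 1 2 1")
        case True
        then show ?thesis using l unfolding S_def by blast
      next
        case False
        \<comment> \<open>If column 1 has the reverse cycle, its cell in row 1 has its partner in
          row 3; seen from there the arrow goes from 3 to 1, so the partner's column has the forward
          cycle.\<close>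
        then have "meets m C 1 3 1" using dir l by blast
        then obtain j where "j \<in> {1..m}" "C 1 1 = C 3 j" by (auto simp: meets_def)
        then have "meets m C 3 1 j" using l by (auto simp: meets_def intro: bexI[of _ 1])
        then show ?thesis using dir \<open>j \<in> {1..m}\<close> unfolding S_def by blast
      qed
    qed
    fix x assume "x \<in> {inv\<^bsub>G\<^esub> a 2 \<otimes>\<^bsub>G\<^esub> a 1, inv\<^bsub>G\<^esub> a 3 \<otimes>\<^bsub>G\<^esub> a 2, inv\<^bsub>G\<^esub> a 1 \<otimes>\<^bsub>G\<^esub> a 3}"
    then obtain i i' where i: "(i, i') \<in> {(1, 2), (2, 3), (3, 1)}" and x: "x = inv\<^bsub>G\<^esub> a i' \<otimes>\<^bsub>G\<^esub> a i"
      using cases by blast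
    have i3: "i \<in> {1..3}" "i' \<in> {1..3}" using i by auto
    have fwd: "meets m C i i' l \<longleftrightarrow> meets m C 1 2 l"
      and bwd: "meets m C i' i l \<longleftrightarrow> \<not> meets m C 1 2 l" if "l \<in> {1..m}" for l
      using i dir[OF that] by auto
    show "x \<otimes>\<^bsub>G\<^esub> s \<in> T" if s: "s \<in> S" for s
    proof -
      obtain l where l: "l \<in> {1..m}" "meets m C i i' l" "s = b l"
        using s fwd unfolding S_def by blast
      then obtain j where j: "j \<in> {1..m}" "C i l = C i' j" by (auto simp: meets_def)
      \<comment> \<open>The same equality of entries, read from its other end, reverses the arrow:
        paired cells lie in columns of opposite direction.\<close>
      then have "meets m C i' i j" unfolding meets_def using l by metis
      then have "b j \<in> T" using bwd j unfolding T_def by blast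
      then show ?thesis using step[OF i3 l(1) j] x l by simp
    qed
    show "inv\<^bsub>G\<^esub> x \<otimes>\<^bsub>G\<^esub> t \<in> S" if t: "t \<in> T" for t
    proof -
      obtain j where j: "j \<in> {1..m}" "meets m C i' i j" "t = b j"
        using t bwd unfolding T_def by blast
      then obtain l where l: "l \<in> {1..m}" "C i' j = C i l" by (auto simp: meets_def)
      then have "meets m C i i' l" unfolding meets_def using j by metis
      then have "b l \<in> S" using fwd l unfolding S_def by blast
      \<comment> \<open>The inverse of \<open>x\<close> is the difference with \<open>i\<close> and
        \<open>i'\<close> exchanged, so \<open>step\<close> applies with the rows swapped.\<close>
      moreover have "inv\<^bsub>G\<^esub> x \<otimes>\<^bsub>G\<^esub> t = b l"
        using step[OF i3(2,1) j(1) l] x j a i3 by (simp add: inv_mult_group)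
      ultimately show ?thesis by simp
    qed
  qed
qed

end
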